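(* Let $\nu>0$ be a real number. Then the set of irrational real numbers $x$ such that $B_{\{\nu\}}(x)<\infty$ is contained in $\mathrm{C}(1/\nu)$, and it contains $\mathrm{C}\left(\frac{1}{\nu}-\varepsilon\right)$ for every real $\varepsilon$ with $0<\varepsilon\le 1/\nu$.
   Context: For an irrational real number $x$, the Gauss continued fraction algorithm defines $x_0=x-\lfloor x\rfloor\in(0,1)$ and, for all $n\ge 0$, $x_{n+1}=\frac{1}{x_n}-\left\lfloor \frac{1}{x_n}\right\rfloor\in(0,1)$. Set $\beta_{-1}(x)=1$ and $\beta_n(x)=x_0x_1\cdots x_n$ for $n\ge 0$. For $\nu>0$, the Brjuno series associated with the function $t\mapsto t^{-\nu}$ on $(0,1)$ is $$B_{\{\nu\}}(x)=\sum_{n=0}^{\infty}\beta_{n-1}(x)\,x_n^{-\nu}\in(0,+\infty],$$ a series of positive terms whose sum may be $+\infty$. For a real number $\tau\ge 0$, $\mathrm{C}(\tau)$ denotes the set of irrational real numbers $x$ (diophantine numbers of order $\tau$) for which there exists a constant $c>0$ such that for all integers $p$ and $q$ with $q>0$ one has $\left|x-\frac{p}{q}\right|\ge c\,q^{-2-\tau}$. *)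

theory Defs
  imports "HOL-Analysis.Analysis"
begin

fun gauss_iter :: "real \<Rightarrow> nat \<Rightarrow> real" where
  "gauss_iter x 0 = x - of_int \<lfloor>x\<rfloor>"
| "gauss_iter x (Suc n) = 1 / gauss_iter x n - of_int \<lfloor>1 / gauss_iter x n\<rfloor>"

text \<open>Indices are shifted by one to stay within the naturals: \<open>beta_pred x n\<close> is
  \<open>\<beta>\<^sub>n\<^sub>-\<^sub>1(x)\<close>, so that \<open>beta_pred x 0 = 1\<close> is \<open>\<beta>\<^sub>-\<^sub>1(x)\<close>.\<close>

definition beta_pred :: "real \<Rightarrow> nat \<Rightarrow> real" where
  "beta_pred x n = (\<Prod>k<n. gauss_iter x k)"

text \<open>The sum is taken in the extended nonnegative reals, so that a divergent series has
  the value \<open>\<infinity>\<close>. For irrational \<open>x\<close> every term is positive, so \<open>ennreal\<close> truncates nothing.\<close>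

definition brjuno_series :: "real \<Rightarrow> real \<Rightarrow> ennreal" where
  "brjuno_series \<nu> x = (\<Sum>n. ennreal (beta_pred x n * gauss_iter x n powr (- \<nu>)))"

definition diophantine :: "real \<Rightarrow> real set" where
  "diophantine \<tau> = {x. x \<notin> \<rat> \<and>
     (\<exists>c>0. \<forall>p q :: int. q > 0 \<longrightarrow>
        \<bar>x - of_int p / of_int q\<bar> \<ge> c * of_int q powr (- 2 - \<tau>))}"

end

theory Submission
  imports Defs
begin

text \<open>
  Write \<open>b n\<close> for \<open>\<beta>\<^sub>n\<^sub>-\<^sub>1(x)\<close>. Since \<open>x\<^sub>n = b (n+1) / b n\<close>, the \<open>n\<close>-th term of the Brjuno series is
  \<open>b n powr (1 + \<nu>) * b (n+1) powr (- \<nu>)\<close>. It is therefore bounded exactly when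
  \<open>b (n+1) \<ge> c * b n powr (1 + 1/\<nu>)\<close>, and such an inequality between consecutive \<open>b\<close>'s is a
  diophantine condition in disguise. Indeed the \<open>n\<close>-th convergent \<open>p/q\<close> satisfies
  \<open>\<bar>q x - p\<bar> = b (n+1)\<close> and \<open>q * b n \<le> 1\<close> (lemma \<open>convergent\<close>).

  If the series converges, its terms are bounded. Given an arbitrary fraction \<open>p/q\<close>, let \<open>n\<close> be the
  last index with \<open>b n > 1/(2q)\<close>. A weak form of the best approximation property
  (lemma \<open>linear_form_lower_bound\<close>) gives \<open>\<bar>q x - p\<bar> \<ge> b (n+1) / 2\<close>, and the right-hand side is at
  least a constant times \<open>b n powr (1 + 1/\<nu>)\<close>, hence a constant times \<open>q powr (- 1 - 1/\<nu>)\<close>.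

  Conversely, if \<open>x\<close> is diophantine of order \<open>\<tau> = 1/\<nu> - \<epsilon>\<close>, applying the hypothesis to the
  convergents gives \<open>b (n+1) \<ge> c * b n powr (1 + \<tau>)\<close>, so that the \<open>n\<close>-th term is at most
  \<open>c powr (- \<nu>) * b n powr (\<nu> \<epsilon>)\<close>. The series of these majorants converges because \<open>b\<close> decreases
  at least geometrically (lemma \<open>beta_geometric\<close>).
\<close>

section \<open>The Gauss iterates and their products\<close>

lemma gauss_iter_irrational:
  assumes "x \<notin> \<rat>"
  shows "gauss_iter x n \<notin> \<rat>"
proof (induction n)
  case 0
  show ?case
  proof
    assume "gauss_iter x 0 \<in> \<rat>"
    then have "gauss_iter x 0 + of_int \<lfloor>x\<rfloor> \<in> \<rat>" by (intro Rats_add) auto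
    then show False using assms by simp
  qed
next
  case (Suc n)
  show ?case
  proof
    assume "gauss_iter x (Suc n) \<in> \<rat>"
    then have "gauss_iter x (Suc n) + of_int \<lfloor>1 / gauss_iter x n\<rfloor> \<in> \<rat>" by (intro Rats_add) auto
    then have "1 / gauss_iter x n \<in> \<rat>" by simp
    then have "1 / (1 / gauss_iter x n) \<in> \<rat>" by (rule Rats_divide[OF Rats_1])
    then show False using Suc by simp
  qed
qed

lemma gauss_iter_bounds:
  assumes "x \<notin> \<rat>"
  shows "0 < gauss_iter x n" "gauss_iter x n < 1"
proof -
  have frac: "\<exists>y. gauss_iter x n = frac y"
    by (cases n) (auto simp: frac_def)
  then have "0 \<le> gauss_iter x n" "gauss_iter x n < 1"
    using frac_ge_0 frac_lt_1 by metis+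
  moreover have "gauss_iter x n \<noteq> 0"
    using gauss_iter_irrational[OF assms, of n] by (metis Rats_0)
  ultimately show "0 < gauss_iter x n" "gauss_iter x n < 1" by auto
qed

lemma beta_pred_0 [simp]: "beta_pred x 0 = 1"
  by (simp add: beta_pred_def)

lemma beta_pred_Suc: "beta_pred x (Suc n) = beta_pred x n * gauss_iter x n"
  by (simp add: beta_pred_def)

lemma beta_pred_pos:
  assumes "x \<notin> \<rat>"
  shows "0 < beta_pred x n"
  unfolding beta_pred_def by (intro prod_pos) (auto simp: gauss_iter_bounds[OF assms])

lemma beta_pred_Suc_less:
  assumes "x \<notin> \<rat>"
  shows "beta_pred x (Suc n) < beta_pred x n"
  using beta_pred_pos[OF assms, of n] gauss_iter_bounds[OF assms, of n]
  by (simp add: beta_pred_Suc)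

lemma beta_pred_recurrence:
  assumes "x \<notin> \<rat>"
  shows "beta_pred x (Suc (Suc n)) =
    beta_pred x n - of_int \<lfloor>1 / gauss_iter x n\<rfloor> * beta_pred x (Suc n)"
  using gauss_iter_bounds[OF assms, of n] by (simp add: beta_pred_Suc field_simps)

lemma partial_quotient_ge_1:
  assumes "x \<notin> \<rat>"
  shows "\<lfloor>1 / gauss_iter x n\<rfloor> \<ge> 1"
  using gauss_iter_bounds[OF assms, of n] by (simp add: le_floor_iff)

text \<open>Two consecutive steps at least halve \<open>\<beta>\<close>, because \<open>\<beta>\<^sub>n\<^sub>-\<^sub>1 \<ge> \<beta>\<^sub>n + \<beta>\<^sub>n\<^sub>+\<^sub>1 \<ge> 2 \<beta>\<^sub>n\<^sub>+\<^sub>1\<close>; the factor \<open>2\<close>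
  absorbs the odd indices.\<close>

lemma beta_geometric:
  assumes "x \<notin> \<rat>"
  shows "beta_pred x n \<le> 2 * sqrt (1/2) ^ n"
proof -
  have half: "beta_pred x (Suc (Suc n)) \<le> beta_pred x n / 2" for n
  proof -
    have "1 * beta_pred x (Suc n) \<le> of_int \<lfloor>1 / gauss_iter x n\<rfloor> * beta_pred x (Suc n)"
      using partial_quotient_ge_1[OF assms, of n] beta_pred_pos[OF assms, of "Suc n"]
      by (intro mult_right_mono) auto
    then show ?thesis
      using beta_pred_recurrence[OF assms, of n] beta_pred_Suc_less[OF assms, of "Suc n"]
      by linarith
  qed
  show ?thesis
  proof (induction n rule: induct_nat_012)
    case 0
    show ?case by simp
  next
    case 1
    have "sqrt (1/2) \<ge> 1/2" by (rule real_le_rsqrt) (simp add: power2_eq_square)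
    then show ?case using beta_pred_Suc_less[OF assms, of 0] by simp
  next
    case (ge2 n)
    have "sqrt (1/2) ^ Suc (Suc n) = (sqrt (1/2))\<^sup>2 * sqrt (1/2) ^ n"
      unfolding power2_eq_square by (simp only: power_Suc mult.assoc)
    also have "(sqrt (1/2))\<^sup>2 = 1/2" by (rule real_sqrt_pow2) simp
    finally show ?case using half[of n] ge2(1) by linarith
  qed
qed

section \<open>Convergents and best approximation\<close>

text \<open>The convergents of \<open>x\<close>, obtained together with their predecessors by the usual recurrence
  \<open>q\<^sub>n\<^sub>+\<^sub>1 = a\<^sub>n\<^sub>+\<^sub>1 q\<^sub>n + q\<^sub>n\<^sub>-\<^sub>1\<close>, starting from \<open>q\<^sub>0 = 1\<close> and \<open>q\<^sub>-\<^sub>1 = 0\<close>. The \<open>\<beta>\<close>'s satisfy the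
  same recurrence up to sign, which makes the last two expressions invariant.\<close>

lemma consecutive_convergents:
  assumes "x \<notin> \<rat>"
  shows "\<exists>p q p' q' :: int. q > 0 \<and> q' \<ge> 0 \<and>
    of_int q * x - of_int p = (-1) ^ n * beta_pred x (Suc n) \<and>
    of_int q' * x - of_int p' = - ((-1) ^ n * beta_pred x n) \<and>
    of_int q * beta_pred x n + of_int q' * beta_pred x (Suc n) = 1 \<and>
    \<bar>p * q' - q * p'\<bar> = 1"
proof (induction n)
  case 0
  show ?case
    by (rule exI[of _ "\<lfloor>x\<rfloor>"], rule exI[of _ 1], rule exI[of _ 1], rule exI[of _ 0])
      (simp add: beta_pred_Suc)
next
  case (Suc n)
  then obtain p q p' q' :: int where *: "q > 0" "q' \<ge> 0"
    "of_int q * x - of_int p = (-1) ^ n * beta_pred x (Suc n)"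
    "of_int q' * x - of_int p' = - ((-1) ^ n * beta_pred x n)"
    "of_int q * beta_pred x n + of_int q' * beta_pred x (Suc n) = 1"
    "\<bar>p * q' - q * p'\<bar> = 1"
    by blast
  define a where "a = \<lfloor>1 / gauss_iter x n\<rfloor>"
  have a: "a \<ge> 1" using partial_quotient_ge_1[OF assms] by (simp add: a_def)
  have rec: "beta_pred x (Suc (Suc n)) = beta_pred x n - of_int a * beta_pred x (Suc n)"
    using beta_pred_recurrence[OF assms] by (simp add: a_def)
  have "a * q + q' > 0" using a *(1,2) by (simp add: add_pos_nonneg)
  moreover have "of_int (a * q + q') * x - of_int (a * p + p')
      = (-1) ^ Suc n * beta_pred x (Suc (Suc n))"
  proof -
    have "of_int (a * q + q') * x - of_int (a * p + p')
        = of_int a * (of_int q * x - of_int p) + (of_int q' * x - of_int p')"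
      by (simp add: algebra_simps)
    also have "\<dots> = (-1) ^ Suc n * beta_pred x (Suc (Suc n))"
      unfolding *(3,4) rec by (simp add: algebra_simps)
    finally show ?thesis .
  qed
  moreover have "of_int q * x - of_int p = - ((-1) ^ Suc n * beta_pred x (Suc n))"
    using *(3) by simp
  moreover have "of_int (a * q + q') * beta_pred x (Suc n) + of_int q * beta_pred x (Suc (Suc n)) = 1"
    using *(5) unfolding rec by (simp add: algebra_simps)
  moreover have "\<bar>(a * p + p') * q - (a * q + q') * p\<bar> = 1"
    using *(6) by (simp add: algebra_simps abs_minus_commute)
  ultimately show ?case using \<open>q > 0\<close> by (metis less_imp_le)
qed

lemma convergent:
  assumes "x \<notin> \<rat>"
  obtains p q :: int where "q > 0" "coprime p q"
    "\<bar>of_int q * x - of_int p\<bar> = beta_pred x (Suc n)" "of_int q * beta_pred x n \<le> 1"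
proof -
  obtain p q p' q' :: int where *: "q > 0" "q' \<ge> 0"
    "of_int q * x - of_int p = (-1) ^ n * beta_pred x (Suc n)"
    "of_int q * beta_pred x n + of_int q' * beta_pred x (Suc n) = 1"
    "\<bar>p * q' - q * p'\<bar> = 1"
    using consecutive_convergents[OF assms, of n] by blast
  have "coprime p q"
  proof (rule coprimeI)
    fix d assume "d dvd p" "d dvd q"
    then have "d dvd p * q' - q * p'" by simp
    then show "is_unit d" using *(5) by (metis dvd_abs_iff)
  qed
  moreover have "\<bar>of_int q * x - of_int p\<bar> = beta_pred x (Suc n)"
    unfolding *(3) using beta_pred_pos[OF assms, of "Suc n"] by (simp add: abs_mult power_abs)
  moreover have "0 \<le> of_int q' * beta_pred x (Suc n)"
    using *(2) beta_pred_pos[OF assms, of "Suc n"] by simp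
  then have "of_int q * beta_pred x n \<le> 1" using *(4) by linarith
  ultimately show ?thesis using that *(1) by blast
qed

text \<open>A weak best approximation property. Let \<open>P/Q\<close> be the convergent with
  \<open>\<bar>Q x - P\<bar> = \<beta>\<^sub>n\<close>. If \<open>p/q\<close> differs from it, the nonzero integer \<open>q P - p Q\<close> equals
  \<open>Q (q x - p) - q (Q x - P)\<close>, where the second product is at most \<open>1/2\<close>; so the first one
  is at least \<open>1/2\<close>.\<close>

lemma linear_form_lower_bound:
  fixes p q :: int
  assumes "x \<notin> \<rat>" "q > 0" "of_int q * beta_pred x (Suc n) \<le> 1 / 2"
  shows "beta_pred x (Suc n) / 2 \<le> \<bar>of_int q * x - of_int p\<bar>"
proof -
  define b where "b = beta_pred x (Suc n)"
  obtain P Q :: int where *: "Q > 0" "coprime P Q"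
    "\<bar>of_int Q * x - of_int P\<bar> = b" "of_int Q * beta_pred x n \<le> 1"
    using convergent[OF assms(1), of n] unfolding b_def by blast
  have b: "b > 0" using beta_pred_pos[OF assms(1)] by (simp add: b_def)
  define L where "L = \<bar>of_int q * x - of_int p\<bar>"
  have "b / 2 \<le> L"
  proof (cases "q * P = p * Q")
    case True
    then have "Q dvd q" using *(2)
      by (metis coprime_commute coprime_dvd_mult_left_iff dvd_triv_right)
    then have "Q \<le> q" using assms(2) by (simp add: zdvd_imp_le)
    have eq: "of_int q * real_of_int P = of_int p * of_int Q"
      using True by (metis of_int_mult)
    have "of_int Q * (of_int q * x - of_int p) = of_int q * (of_int Q * x - of_int P)"
      using eq by (simp add: algebra_simps)
    then have "\<bar>of_int Q * (of_int q * x - of_int p)\<bar> = \<bar>of_int q * (of_int Q * x - of_int P)\<bar>"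
      by simp
    then have "of_int Q * L = of_int q * b"
      using assms(2) *(1,3) by (simp add: abs_mult L_def)
    also have "of_int q * b \<ge> of_int Q * b"
      using \<open>Q \<le> q\<close> b by (intro mult_right_mono) auto
    finally have "b \<le> L" using *(1) by simp
    then show ?thesis using b by simp
  next
    case False
    then have "1 \<le> \<bar>q * P - p * Q\<bar>" by simp
    then have "1 \<le> \<bar>real_of_int (q * P - p * Q)\<bar>" by linarith
    also have "real_of_int (q * P - p * Q)
        = of_int Q * (of_int q * x - of_int p) - of_int q * (of_int Q * x - of_int P)"
      by (simp add: algebra_simps)
    also have "\<bar>\<dots>\<bar> \<le> \<bar>of_int Q * (of_int q * x - of_int p)\<bar> + \<bar>of_int q * (of_int Q * x - of_int P)\<bar>"
      by (rule abs_triangle_ineq4)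
    also have "\<dots> = of_int Q * L + of_int q * b"
      using assms(2) *(1,3) by (simp add: abs_mult L_def)
    finally have "of_int Q * L \<ge> 1 / 2" using assms(3) by (simp add: b_def)
    moreover have "of_int Q * b \<le> of_int Q * beta_pred x n"
      using *(1) beta_pred_Suc_less[OF assms(1), of n]
      by (intro mult_left_mono) (auto simp: b_def)
    ultimately have "of_int Q * (b / 2) \<le> of_int Q * L" using *(4) by simp
    then show ?thesis using *(1) by simp
  qed
  then show ?thesis by (simp add: b_def L_def)
qed

section \<open>Brjuno series and diophantine conditions\<close>

lemma brjuno_term_eq:
  assumes "x \<notin> \<rat>"
  shows "beta_pred x n * gauss_iter x n powr (- \<nu>)
    = beta_pred x n powr (1 + \<nu>) * beta_pred x (Suc n) powr (- \<nu>)"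
proof -
  have b: "0 < beta_pred x n" and g: "0 < gauss_iter x n"
    using beta_pred_pos[OF assms] gauss_iter_bounds[OF assms] by auto
  then show ?thesis
    by (simp add: beta_pred_Suc powr_mult powr_add powr_minus field_simps)
qed

text \<open>The exponent \<open>1 + 1/\<nu>\<close> arises by solving \<open>b\<^sub>n\<^bsup>1+\<nu>\<^esup> b\<^sub>n\<^sub>+\<^sub>1\<^bsup>-\<nu>\<^esup> \<le> M\<close> for \<open>b\<^sub>n\<^sub>+\<^sub>1\<close>.\<close>

lemma brjuno_finite_imp_beta_bound:
  assumes "\<nu> > 0" "x \<notin> \<rat>" "brjuno_series \<nu> x < \<infinity>"
  obtains c where "c > 0" "\<And>n. beta_pred x (Suc n) \<ge> c * beta_pred x n powr (1 + 1 / \<nu>)"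
proof -
  obtain M where M: "brjuno_series \<nu> x = ennreal M" "M \<ge> 0"
    using assms(3) by (cases "brjuno_series \<nu> x") auto
  \<comment> \<open>a positive bound, so that negative powers of it make sense\<close>
  define K where "K = M + 1"
  have K: "K > 0" using M by (simp add: K_def)
  have bound: "K powr (- 1 / \<nu>) * beta_pred x n powr (1 + 1 / \<nu>) \<le> beta_pred x (Suc n)" for n
  proof -
    have b: "0 < beta_pred x n" "0 < beta_pred x (Suc n)" using beta_pred_pos[OF assms(2)] by auto
    have "ennreal (beta_pred x n * gauss_iter x n powr (- \<nu>)) \<le> ennreal M"
      unfolding M(1)[symmetric] brjuno_series_def
      using sum_le_suminf[OF summableI, of "{n}" "\<lambda>n. ennreal (beta_pred x n * gauss_iter x n powr (- \<nu>))"]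
      by simp
    then have "beta_pred x n powr (1 + \<nu>) * beta_pred x (Suc n) powr (- \<nu>) \<le> K"
      unfolding brjuno_term_eq[OF assms(2)] using M(2) by (simp add: K_def)
    then have "beta_pred x n powr (1 + \<nu>) \<le> K * beta_pred x (Suc n) powr \<nu>"
      using b by (simp add: powr_minus field_simps)
    then have "(beta_pred x n powr (1 + \<nu>)) powr (1 / \<nu>) \<le> (K * beta_pred x (Suc n) powr \<nu>) powr (1 / \<nu>)"
      using assms(1) by (intro powr_mono2) auto
    also have "(beta_pred x n powr (1 + \<nu>)) powr (1 / \<nu>) = beta_pred x n powr (1 + 1 / \<nu>)"
      using assms(1) by (simp add: powr_powr field_simps)
    also have "(K * beta_pred x (Suc n) powr \<nu>) powr (1 / \<nu>) = K powr (1 / \<nu>) * beta_pred x (Suc n)"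
      using assms(1) K b by (simp add: powr_mult powr_powr)
    finally show ?thesis using K by (simp add: powr_minus field_simps)
  qed
  show ?thesis by (rule that[of "K powr (- 1 / \<nu>)"]) (use K bound in auto)
qed

lemma brjuno_finite_imp_diophantine:
  assumes "\<nu> > 0" "x \<notin> \<rat>" "brjuno_series \<nu> x < \<infinity>"
  shows "x \<in> diophantine (1 / \<nu>)"
proof -
  obtain c where c: "c > 0" "\<And>n. beta_pred x (Suc n) \<ge> c * beta_pred x n powr (1 + 1 / \<nu>)"
    using brjuno_finite_imp_beta_bound[OF assms] by blast
  \<comment> \<open>one factor \<open>1/2\<close> comes from \<open>b n > 1/(2q)\<close>, the other from the weak best approximation bound\<close>
  define d where "d = c * (1/2) powr (1 + 1 / \<nu>) / 2"
  have "d * of_int q powr (- 2 - 1 / \<nu>) \<le> \<bar>x - of_int p / of_int q\<bar>" if q: "q > 0" for p q :: int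
  proof -
    define r where "r = real_of_int q"
    have r: "r \<ge> 1" using q by (simp add: r_def)
    have "(\<lambda>n. 2 * sqrt (1/2) ^ n) \<longlonglongrightarrow> 2 * 0"
      by (intro tendsto_mult tendsto_const LIMSEQ_power_zero) (simp add: real_sqrt_less_iff[of _ 1, simplified])
    then have "eventually (\<lambda>n. 2 * sqrt (1/2) ^ n < 1 / (2 * r)) sequentially"
      by (rule order_tendstoD(2)) (use r in simp)
    then obtain N where "2 * sqrt (1/2) ^ N < 1 / (2 * r)"
      by (auto simp: eventually_sequentially)
    then have ex: "beta_pred x N \<le> 1 / (2 * r)"
      using beta_geometric[OF assms(2), of N] by linarith
    have not0: "\<not> beta_pred x 0 \<le> 1 / (2 * r)" using r by (simp add: field_simps)
    obtain n where n: "\<not> beta_pred x n \<le> 1 / (2 * r)" "beta_pred x (Suc n) \<le> 1 / (2 * r)"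
      using ex_least_nat_less[of "\<lambda>n. beta_pred x n \<le> 1 / (2 * r)", OF ex not0] by blast
    have "d * r powr (- 1 - 1 / \<nu>) = c * (1 / (2 * r)) powr (1 + 1 / \<nu>) / 2"
    proof -
      have "(1 / (2 * r)) powr (1 + 1 / \<nu>) = (1/2) powr (1 + 1 / \<nu>) * (1 / r) powr (1 + 1 / \<nu>)"
        using r powr_mult[of "1/2" "1/r" "1 + 1/\<nu>"] by simp
      moreover have "(1 / r) powr (1 + 1 / \<nu>) = r powr (- 1 - 1 / \<nu>)"
        using r powr_minus_divide[of r "1 + 1/\<nu>"] by (simp add: powr_divide)
      ultimately show ?thesis by (simp add: d_def)
    qed
    also have "\<dots> \<le> c * beta_pred x n powr (1 + 1 / \<nu>) / 2"
      using c(1) n(1) r assms(1) by (intro divide_right_mono mult_left_mono powr_mono2) auto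
    also have "\<dots> \<le> beta_pred x (Suc n) / 2" using c(2)[of n] by simp
    also have "\<dots> \<le> \<bar>r * x - of_int p\<bar>"
      unfolding r_def
      by (rule linear_form_lower_bound[OF assms(2) q]) (use n(2) q in \<open>simp add: r_def field_simps\<close>)
    finally have "d * r powr (- 1 - 1 / \<nu>) / r \<le> \<bar>r * x - of_int p\<bar> / r"
      using r by (intro divide_right_mono) auto
    also have "\<bar>r * x - of_int p\<bar> / r = \<bar>x - of_int p / r\<bar>"
    proof -
      have "\<bar>r * x - of_int p\<bar> / r = \<bar>(r * x - of_int p) / r\<bar>" using r by simp
      also have "(r * x - of_int p) / r = x - of_int p / r" using r by (simp add: field_simps)
      finally show ?thesis .
    qed
    also have "d * r powr (- 1 - 1 / \<nu>) / r = d * r powr (- 2 - 1 / \<nu>)"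
    proof -
      have "r powr (- 2 - 1 / \<nu>) = r powr ((- 1 - 1 / \<nu>) - 1)" by simp
      also have "\<dots> = r powr (- 1 - 1 / \<nu>) / r powr 1" by (rule powr_diff)
      finally show ?thesis using r by simp
    qed
    finally show ?thesis by (simp add: r_def)
  qed
  moreover have "d > 0" using c(1) by (simp add: d_def)
  ultimately show ?thesis using assms(2) unfolding diophantine_def by blast
qed

lemma diophantine_imp_beta_bound:
  assumes "\<tau> \<ge> 0" "x \<in> diophantine \<tau>"
  obtains c where "c > 0" "\<And>n. beta_pred x (Suc n) \<ge> c * beta_pred x n powr (1 + \<tau>)"
proof -
  obtain c where c: "c > 0"
    "\<And>p q :: int. q > 0 \<Longrightarrow> \<bar>x - of_int p / of_int q\<bar> \<ge> c * of_int q powr (- 2 - \<tau>)"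
    and x: "x \<notin> \<rat>"
    using assms(2) by (auto simp: diophantine_def)
  have "c * beta_pred x n powr (1 + \<tau>) \<le> beta_pred x (Suc n)" for n
  proof -
    obtain p q :: int where *: "q > 0"
      "\<bar>of_int q * x - of_int p\<bar> = beta_pred x (Suc n)" "of_int q * beta_pred x n \<le> 1"
      using convergent[OF x, of n] by blast
    define r where "r = real_of_int q"
    have r: "r > 0" using *(1) by (simp add: r_def)
    have b: "0 < beta_pred x n" using beta_pred_pos[OF x] .
    have "beta_pred x n \<le> 1 / r" using *(3) r by (simp add: r_def field_simps)
    then have "c * beta_pred x n powr (1 + \<tau>) \<le> c * (1 / r) powr (1 + \<tau>)"
      using c(1) b assms(1) by (intro mult_left_mono powr_mono2) auto
    also have "(1 / r) powr (1 + \<tau>) = r powr (- 1 - \<tau>)"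
      using r powr_minus_divide[of r "1 + \<tau>"] by (simp add: powr_divide)
    also have "\<dots> = r powr (- 2 - \<tau>) * r"
      using r powr_add[of r "- 2 - \<tau>" 1] by simp
    also have "c * (r powr (- 2 - \<tau>) * r) \<le> \<bar>x - of_int p / r\<bar> * r"
      using c(2)[OF *(1), of p] r by (simp add: r_def mult.assoc[symmetric])
    also have "\<bar>x - of_int p / r\<bar> * r = \<bar>(x - of_int p / r) * r\<bar>"
      using r by (simp add: abs_mult)
    also have "(x - of_int p / r) * r = r * x - of_int p" using r by (simp add: field_simps)
    also have "\<bar>\<dots>\<bar> = beta_pred x (Suc n)" using *(2) by (simp add: r_def)
    finally show ?thesis .
  qed
  with c(1) show ?thesis using that by blast
qed

lemma summable_beta_powr:
  assumes "x \<notin> \<rat>" "s > 0"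
  shows "summable (\<lambda>n. beta_pred x n powr s)"
proof (rule summable_comparison_test')
  have "sqrt (1/2) powr s < 1 powr s"
    using assms(2) by (intro powr_less_mono2) (auto simp: real_sqrt_less_iff[of _ 1, simplified])
  then show "summable (\<lambda>n. 2 powr s * (sqrt (1/2) powr s) ^ n)"
    by (intro summable_mult summable_geometric) simp
  fix n :: nat assume "n \<ge> 0"
  have "beta_pred x n powr s \<le> (2 * sqrt (1/2) ^ n) powr s"
    using beta_geometric[OF assms(1)] beta_pred_pos[OF assms(1), of n] assms(2)
    by (intro powr_mono2) auto
  also have "\<dots> = 2 powr s * (sqrt (1/2) powr s) ^ n"
    by (simp add: powr_mult powr_realpow[symmetric] powr_powr mult.commute)
  finally show "norm (beta_pred x n powr s) \<le> 2 powr s * (sqrt (1/2) powr s) ^ n" by simp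
qed

lemma diophantine_imp_brjuno_finite:
  assumes "\<nu> > 0" "0 < \<epsilon>" "\<epsilon> \<le> 1 / \<nu>" "x \<in> diophantine (1 / \<nu> - \<epsilon>)"
  shows "brjuno_series \<nu> x < \<infinity>"
proof -
  have x: "x \<notin> \<rat>" using assms(4) by (simp add: diophantine_def)
  obtain c where c: "c > 0" "\<And>n. beta_pred x (Suc n) \<ge> c * beta_pred x n powr (1 + (1 / \<nu> - \<epsilon>))"
    using diophantine_imp_beta_bound[of "1 / \<nu> - \<epsilon>" x] assms(3,4) by auto
  define t where "t = (\<lambda>n. beta_pred x n * gauss_iter x n powr (- \<nu>))"
  have t_nonneg: "t n \<ge> 0" for n
    using beta_pred_pos[OF x, of n] by (simp add: t_def)
  have t_le: "t n \<le> c powr (- \<nu>) * beta_pred x n powr (\<nu> * \<epsilon>)" for n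
  proof -
    have b: "0 < beta_pred x n" using beta_pred_pos[OF x] .
    have "t n = beta_pred x n powr (1 + \<nu>) * beta_pred x (Suc n) powr (- \<nu>)"
      unfolding t_def by (rule brjuno_term_eq[OF x])
    also have "\<dots> \<le> beta_pred x n powr (1 + \<nu>) * (c * beta_pred x n powr (1 + (1 / \<nu> - \<epsilon>))) powr (- \<nu>)"
      using c b assms(1) by (intro mult_left_mono powr_mono2') auto
    also have "\<dots> = c powr (- \<nu>) * beta_pred x n powr ((1 + \<nu>) + (1 + (1 / \<nu> - \<epsilon>)) * (- \<nu>))"
      unfolding powr_add[of _ "1 + \<nu>"] using b c(1) by (simp add: powr_mult powr_powr)
    also have "(1 + \<nu>) + (1 + (1 / \<nu> - \<epsilon>)) * (- \<nu>) = \<nu> * \<epsilon>"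
      using assms(1) by (simp add: field_simps)
    finally show ?thesis .
  qed
  have "summable (\<lambda>n. c powr (- \<nu>) * beta_pred x n powr (\<nu> * \<epsilon>))"
    using assms(1,2) by (intro summable_mult summable_beta_powr[OF x]) simp
  then have "summable t"
    by (rule summable_comparison_test') (use t_nonneg t_le in auto)
  then have "(\<Sum>n. ennreal (t n)) = ennreal (suminf t)"
    using t_nonneg by (intro suminf_ennreal2)
  then show ?thesis by (simp add: brjuno_series_def t_def)
qed

theorem mainTheorem1:
  fixes \<nu> :: real
  assumes "\<nu> > 0"
  shows "{x :: real. x \<notin> \<rat> \<and> brjuno_series \<nu> x < \<infinity>} \<subseteq> diophantine (1 / \<nu>) \<and>
    (\<forall>\<epsilon> :: real. 0 < \<epsilon> \<and> \<epsilon> \<le> 1 / \<nu> \<longrightarrow>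
       diophantine (1 / \<nu> - \<epsilon>) \<subseteq> {x :: real. x \<notin> \<rat> \<and> brjuno_series \<nu> x < \<infinity>})"
proof (intro conjI allI impI subsetI)
  fix x assume "x \<in> {x. x \<notin> \<rat> \<and> brjuno_series \<nu> x < \<infinity>}"
  then show "x \<in> diophantine (1 / \<nu>)"
    using brjuno_finite_imp_diophantine[OF assms] by simp
next
  fix \<epsilon> x assume "0 < \<epsilon> \<and> \<epsilon> \<le> 1 / \<nu>" "x \<in> diophantine (1 / \<nu> - \<epsilon>)"
  then show "x \<in> {x. x \<notin> \<rat> \<and> brjuno_series \<nu> x < \<infinity>}"
    using diophantine_imp_brjuno_finite[OF assms] by (auto simp: diophantine_def)
qed

end
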